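(* Let $A\in\mathcal{PC}_{n}$. Then any column of $A$ lies in $\mathcal{E}(A)$.
   Context: A reciprocal (pairwise comparison) matrix of order $n$ is an $n\times n$ real matrix $A=[a_{ij}]$ with all entries positive and $a_{ji}=1/a_{ij}$ for all $1\leq i,j\leq n$ (so its diagonal entries are $1$). The set of all such matrices is denoted $\mathcal{PC}_{n}$. A positive $n$-vector is a vector in $\mathbb{R}^n$ with all entries positive. For a positive $n$-vector $w=[w_1\ \cdots\ w_n]^T$, let $w^{(-T)}=[1/w_1\ \cdots\ 1/w_n]$ be the transpose of its entrywise inverse, so that $ww^{(-T)}=[w_i/w_j]$. For a matrix $B$, $|B|$ denotes the entrywise absolute value, and inequalities between matrices are entrywise. A positive $n$-vector $w$ is efficient for $A\in\mathcal{PC}_{n}$ if, for every positive $n$-vector $v$, the inequality $|vv^{(-T)}-A|\leq|ww^{(-T)}-A|$ implies that $v$ and $w$ are proportional. $\mathcal{E}(A)$ denotes the set of all (positive) vectors that are efficient for $A$. *)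

theory Defs
  imports "HOL-Analysis.Analysis"
begin

definition PC :: "(real^'n^'n) set" where
  "PC = {A. (\<forall>i j. 0 < A $ i $ j) \<and> (\<forall>i j. A $ j $ i = 1 / A $ i $ j)}"

definition positive_vec :: "real^'n \<Rightarrow> bool" where
  "positive_vec w \<longleftrightarrow> (\<forall>i. 0 < w $ i)"

definition inv_transpose :: "real^'n \<Rightarrow> real^'n^1" where
  "inv_transpose w = rowvector (\<chi> i. 1 / w $ i)"

definition ratio_matrix :: "real^'n \<Rightarrow> real^'n^'n" where
  "ratio_matrix w = (columnvector w :: real^1^'n) ** inv_transpose w"

lemma ratio_matrix_eq: "ratio_matrix w = (\<chi> i j. w $ i / w $ j)"
  by (simp add: ratio_matrix_def inv_transpose_def columnvector_def rowvector_def
      matrix_matrix_mult_def vec_eq_iff)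

definition proportional :: "real^'n \<Rightarrow> real^'n \<Rightarrow> bool" where
  "proportional v w \<longleftrightarrow> (\<exists>c::real. c \<noteq> 0 \<and> v = c *\<^sub>R w)"

(* On real^'n^'n the library's absolute value and \<le> are entrywise
   (abs_vec_def, less_eq_vec_def), as spelled out in matrix_abs_le_iff. *)

definition efficient :: "real^'n^'n \<Rightarrow> real^'n \<Rightarrow> bool" where
  "efficient A w \<longleftrightarrow> positive_vec w \<and>
     (\<forall>v. positive_vec v \<longrightarrow>
        \<bar>ratio_matrix v - A\<bar> \<le> \<bar>ratio_matrix w - A\<bar> \<longrightarrow> proportional v w)"

lemma matrix_abs_le_iff:
  fixes B C :: "real^'n^'n"
  shows "\<bar>B\<bar> \<le> \<bar>C\<bar> \<longleftrightarrow> (\<forall>i j. \<bar>B $ i $ j\<bar> \<le> \<bar>C $ i $ j\<bar>)"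
  by (simp add: abs_vec_def less_eq_vec_def)

definition efficient_set :: "real^'n^'n \<Rightarrow> (real^'n) set" where
  "efficient_set A = {w. efficient A w}"

end

theory Submission
  imports Defs
begin

text \<open>
  The \<open>j\<close>-th column \<open>w\<close> of \<open>A\<close> reproduces column \<open>j\<close> of \<open>A\<close> exactly: \<open>w\<^sub>i / w\<^sub>j = a\<^sub>i\<^sub>j\<close>, because
  \<open>w\<^sub>j = a\<^sub>j\<^sub>j = 1\<close>. A vector \<open>v\<close> that approximates \<open>A\<close> entrywise at least as well must therefore
  have error zero in column \<open>j\<close> too, and the ratios \<open>v\<^sub>i / v\<^sub>j = a\<^sub>i\<^sub>j\<close> determine \<open>v\<close> up to the
  factor \<open>v\<^sub>j\<close>.
\<close>

lemma PC_diagonal: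
  fixes A :: "real^'n^'n"
  assumes "A \<in> PC"
  shows "A $ i $ i = 1"
proof -
  have pos: "0 < A $ i $ i" and recip: "A $ i $ i = 1 / A $ i $ i"
    using assms unfolding PC_def by blast+
  have "A $ i $ i * A $ i $ i = 1"
    using pos by (subst (2) recip) simp
  then have "(A $ i $ i)\<^sup>2 = 1"
    by (simp add: power2_eq_square)
  then show ?thesis
    using pos by (simp add: power2_eq_1_iff)
qed

theorem lemma10:
  fixes A :: "real^'n^'n" and j :: 'n
  assumes "A \<in> PC"
  shows "column j A \<in> efficient_set A"
proof -
  have pos: "positive_vec (column j A)"
  proof -
    have "0 < A $ i $ j" for i
      using assms unfolding PC_def by blast
    then show ?thesis
      by (simp add: positive_vec_def column_def)
  qed
  have "proportional v (column j A)"
    if v: "positive_vec v"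
      and le: "\<bar>ratio_matrix v - A\<bar> \<le> \<bar>ratio_matrix (column j A) - A\<bar>" for v
  proof -
    have vj: "0 < v $ j"
      using v by (simp add: positive_vec_def)
    have "v $ i = (v $ j *\<^sub>R column j A) $ i" for i
    proof -
      have "\<bar>v $ i / v $ j - A $ i $ j\<bar> \<le> \<bar>A $ i $ j / A $ j $ j - A $ i $ j\<bar>"
        using le by (simp add: matrix_abs_le_iff ratio_matrix_eq column_def)
      then have "v $ i / v $ j = A $ i $ j"
        by (simp add: PC_diagonal[OF assms])
      then show ?thesis
        using vj by (simp add: column_def field_simps)
    qed
    then have "v = v $ j *\<^sub>R column j A"
      unfolding vec_eq_iff by blast
    moreover have "v $ j \<noteq> 0"
      using vj by simp
    ultimately show ?thesis
      unfolding proportional_def by blast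
  qed
  then show ?thesis
    using pos by (simp add: efficient_set_def efficient_def)
qed

end
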